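(* Let $r\ge2$ and let $H$ be an intersecting $r$-partite hypergraph in which every vertex has positive degree, with $\tau(H)=r$ and maximum degree $\Delta$. Then $$(r+1/2)^2\Delta^2+4r^2\ \ge\ (8r^2-2r)\Delta .$$
   Context: A hypergraph $H$ is a set of non-empty subsets (lines) of a finite vertex set $V(H)$. The degree of a vertex is the number of lines containing it. $H$ is $r$-partite if $V(H)$ is partitioned into $r$ sets (sides) such that every line contains exactly one vertex from each side. A cover is a set of vertices meeting every line; $\tau(H)$ is the minimum size of a cover. $H$ is intersecting if every two lines share at least one vertex. *)

theory Defs
  imports Complex_Main "HOL-Library.Disjoint_Sets"
begin

definition hypergraph :: "'a set \<Rightarrow> 'a set set \<Rightarrow> bool" where
  "hypergraph V H \<longleftrightarrow> finite V \<and> (\<forall>e\<in>H. e \<noteq> {} \<and> e \<subseteq> V)"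

definition degree :: "'a set set \<Rightarrow> 'a \<Rightarrow> nat" where
  "degree H v = card {e \<in> H. v \<in> e}"

text \<open>Only meaningful for nonempty finite \<open>V\<close>, since \<^const>\<open>Max\<close> of the empty set is unspecified.\<close>

definition max_degree :: "'a set \<Rightarrow> 'a set set \<Rightarrow> nat" where
  "max_degree V H = Max (degree H ` V)"

text \<open>The sides are the members of the partition. \<^const>\<open>partition_on\<close> demands that they be
  nonempty, which is automatic as soon as there is at least one line.\<close>

definition partite :: "nat \<Rightarrow> 'a set \<Rightarrow> 'a set set \<Rightarrow> bool" where
  "partite r V H \<longleftrightarrow>
     (\<exists>P. partition_on V P \<and> finite P \<and> card P = r \<and> (\<forall>e\<in>H. \<forall>S\<in>P. \<exists>!v. v \<in> e \<and> v \<in> S))"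

definition cover :: "'a set \<Rightarrow> 'a set set \<Rightarrow> 'a set \<Rightarrow> bool" where
  "cover V H C \<longleftrightarrow> C \<subseteq> V \<and> (\<forall>e\<in>H. C \<inter> e \<noteq> {})"

definition cover_number :: "'a set \<Rightarrow> 'a set set \<Rightarrow> nat" where
  "cover_number V H = Min (card ` {C. cover V H C})"

definition intersecting :: "'a set set \<Rightarrow> bool" where
  "intersecting H \<longleftrightarrow> (\<forall>e\<in>H. \<forall>f\<in>H. e \<inter> f \<noteq> {})"

end

theory Submission
  imports Defs
begin

text \<open>
  Removing from a line a vertex of degree 1 leaves a cover with \<open>r - 1\<close> vertices, so all degrees
  are at least 2.  If a line contained two vertices of degree 2, one could replace both of them by
  a single common vertex of the two other lines through them, and again obtain a cover with
  \<open>r - 1\<close> vertices.  Hence at most \<open>n / 2\<close> vertices have degree 2, where \<open>n = card H\<close>.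
  Every other degree \<open>d\<close> satisfies \<open>(d - 3) (\<Delta> - d) \<ge> 0\<close>.  Sides are covers, so there are at
  least \<open>r\<^sup>2\<close> vertices; the degrees sum to \<open>r n\<close>, and their squares sum to at
  least \<open>n (n + r - 1)\<close> because the lines meet pairwise.  Together this yields
  \<open>n\<^sup>2 - ((r + 1/2) \<Delta> + 2 r) n + 3 r\<^sup>2 \<Delta> \<le> 0\<close>, and the claim says that the discriminant of this
  quadratic in \<open>n\<close> is nonnegative.
\<close>

section \<open>Finiteness, and bounds by minimum and maximum\<close>

lemma finite_lines: "hypergraph V H \<Longrightarrow> finite H"
  unfolding hypergraph_def by (meson PowI finite_Pow_iff finite_subset subsetI)

lemma finite_line: "hypergraph V H \<Longrightarrow> e \<in> H \<Longrightarrow> finite e"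
  unfolding hypergraph_def by (meson finite_subset)

lemma cover_number_le:
  assumes "hypergraph V H" "cover V H C"
  shows "cover_number V H \<le> card C"
proof -
  have "{C. cover V H C} \<subseteq> Pow V"
    by (auto simp: cover_def)
  with assms(1) have "finite {C. cover V H C}"
    unfolding hypergraph_def by (meson finite_Pow_iff finite_subset)
  with assms(2) show ?thesis
    unfolding cover_number_def by (intro Min_le) auto
qed

lemma degree_le_max_degree:
  assumes "finite V" "v \<in> V"
  shows "degree H v \<le> max_degree V H"
  using assms unfolding max_degree_def by (intro Max_ge) auto

section \<open>Sizes forced by the sides\<close>

lemma partite_uniform:
  assumes "hypergraph V H" "partite r V H" "e \<in> H"
  shows "card e = r"
proof -
  obtain P where P: "partition_on V P" "finite P" "card P = r"
      "\<And>S. S \<in> P \<Longrightarrow> \<exists>!v. v \<in> e \<and> v \<in> S"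
    using assms(2,3) unfolding partite_def by blast
  have "e \<subseteq> V"
    using assms(1,3) by (auto simp: hypergraph_def)
  then have "e = (\<Union>S\<in>P. e \<inter> S)"
    using partition_onD1[OF P(1)] by auto
  moreover have "card (\<Union>S\<in>P. e \<inter> S) = (\<Sum>S\<in>P. card (e \<inter> S))"
  proof (rule card_UN_disjoint)
    show "\<forall>S\<in>P. \<forall>S'\<in>P. S \<noteq> S' \<longrightarrow> (e \<inter> S) \<inter> (e \<inter> S') = {}"
      using partition_onD2[OF P(1)] unfolding disjoint_def by blast
  qed (use P(2) finite_line[OF assms(1,3)] in auto)
  moreover have "card (e \<inter> S) = 1" if "S \<in> P" for S
    using P(4)[OF that] by (auto simp: card_1_singleton_iff)
  ultimately show ?thesis
    using P(3) by simp
qed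

text \<open>Serves to identify two vertices of one line that lie on the same side; this excludes
  triangles of lines when \<open>r = 2\<close>.\<close>

lemma partite_side:
  assumes "partite r V H" "x \<in> V"
  obtains S where "x \<in> S" "\<forall>e\<in>H. \<exists>!v. v \<in> e \<and> v \<in> S"
proof -
  obtain P where P: "partition_on V P" "\<forall>e\<in>H. \<forall>S\<in>P. \<exists>!v. v \<in> e \<and> v \<in> S"
    using assms(1) unfolding partite_def by (elim exE conjE)
  obtain S where "S \<in> P" "x \<in> S"
    using partition_onD1[OF P(1)] assms(2) by blast
  with P(2) that show ?thesis by simp
qed

lemma partite_card_vertices:
  assumes "hypergraph V H" "partite r V H" "cover_number V H = r"
  shows "r * r \<le> card V"
proof -
  obtain P where P: "partition_on V P" "finite P" "card P = r"
      "\<And>e S. e \<in> H \<Longrightarrow> S \<in> P \<Longrightarrow> \<exists>!v. v \<in> e \<and> v \<in> S"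
    using assms(2) unfolding partite_def by blast
  have V: "V = \<Union>P"
    using partition_onD1[OF P(1)] .
  have "r \<le> card S" if "S \<in> P" for S
  proof -
    have "cover V H S"
      using that P(4) unfolding cover_def V by blast
    from cover_number_le[OF assms(1) this] assms(3) show ?thesis
      by simp
  qed
  then have "r * r \<le> (\<Sum>S\<in>P. card S)"
    using sum_mono[of P "\<lambda>_. r" card] P(3) by simp
  also have "\<dots> = card V"
    unfolding V
  proof (rule card_Union_disjoint[symmetric])
    show "pairwise disjnt P"
      using partition_onD2[OF P(1)] by (simp add: disjoint_def pairwise_def disjnt_def)
    show "finite S" if "S \<in> P" for S
      using that V assms(1) by (metis Union_upper finite_subset hypergraph_def)
  qed
  finally show ?thesis .
qed

section \<open>Double counting of incidences\<close>

text \<open>Both sides count the incident pairs of a vertex in \<open>A\<close> and a line, weighted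
  by \<open>g\<close>. The weight 1 gives sums of degrees, the weight \<open>degree H\<close> sums
  of their squares.\<close>

lemma sum_degree_mult:
  fixes g :: "'a \<Rightarrow> nat"
  assumes "finite A" "finite H"
  shows "(\<Sum>v\<in>A. degree H v * g v) = (\<Sum>e\<in>H. \<Sum>v\<in>A \<inter> e. g v)"
proof -
  have "(\<Sum>v\<in>A. degree H v * g v) = (\<Sum>v\<in>A. \<Sum>e\<in>{e \<in> H. v \<in> e}. g v)"
    by (simp add: degree_def)
  also have "\<dots> = (\<Sum>e\<in>H. \<Sum>v\<in>{v \<in> A. v \<in> e}. g v)"
    by (rule sum.swap_restrict[OF assms])
  also have "\<dots> = (\<Sum>e\<in>H. \<Sum>v\<in>A \<inter> e. g v)"
    by (simp add: Int_def)
  finally show ?thesis .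
qed

text \<open>The sum counts pairs of a line \<open>f\<close> and a vertex of \<open>e\<close> on
  \<open>f\<close>: the line \<open>e\<close> itself contributes \<open>card e\<close>, every other
  line at least 1.\<close>

lemma sum_degree_line:
  assumes "finite H" "intersecting H" "e \<in> H" "finite e"
  shows "card H - 1 + card e \<le> (\<Sum>v\<in>e. degree H v)"
proof -
  have "(\<Sum>v\<in>e. degree H v) = (\<Sum>f\<in>H. card (e \<inter> f))"
    using sum_degree_mult[OF assms(4,1), of "\<lambda>_. 1"] by simp
  also have "\<dots> = card e + (\<Sum>f\<in>H - {e}. card (e \<inter> f))"
    using assms by (simp add: sum.remove)
  also have "(\<Sum>f\<in>H - {e}. 1) \<le> (\<Sum>f\<in>H - {e}. card (e \<inter> f))"
  proof (rule sum_mono)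
    fix f assume "f \<in> H - {e}"
    with assms have "e \<inter> f \<noteq> {}" "finite (e \<inter> f)"
      by (auto simp: intersecting_def)
    then show "1 \<le> card (e \<inter> f)"
      by (simp add: Suc_leI card_gt_0_iff)
  qed
  ultimately show ?thesis
    using assms by simp
qed

lemma sum_degree_squares:
  assumes "hypergraph V H" "intersecting H" "\<And>e. e \<in> H \<Longrightarrow> card e = r"
  shows "card H * (card H - 1 + r) \<le> (\<Sum>v\<in>V. (degree H v)\<^sup>2)"
proof -
  have fin: "finite V" "finite H"
    using assms(1) finite_lines by (auto simp: hypergraph_def)
  have "card H * (card H - 1 + r) = (\<Sum>e\<in>H. card H - 1 + card e)"
    using assms(3) by simp
  also have "\<dots> \<le> (\<Sum>e\<in>H. \<Sum>v\<in>e. degree H v)"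
    by (intro sum_mono sum_degree_line fin assms(2) finite_line[OF assms(1)])
  also have "\<dots> = (\<Sum>e\<in>H. \<Sum>v\<in>V \<inter> e. degree H v)"
    using assms(1) by (intro sum.cong) (auto simp: hypergraph_def Int_absorb1)
  also have "\<dots> = (\<Sum>v\<in>V. (degree H v)\<^sup>2)"
    using sum_degree_mult[OF fin, of "degree H"] by (simp add: power2_eq_square)
  finally show ?thesis .
qed

section \<open>Vertices of degree 1 and 2\<close>

lemma degree_ge_2:
  assumes H: "hypergraph V H" "intersecting H" "partite r V H" "cover_number V H = r"
    and "r \<ge> 2" and pos: "degree H v > 0"
  shows "degree H v \<ge> 2"
proof (rule ccontr)
  assume "\<not> ?thesis"
  with pos have "card {e \<in> H. v \<in> e} = 1"
    by (simp add: degree_def)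
  then obtain e where e: "{e \<in> H. v \<in> e} = {e}"
    by (auto simp: card_1_singleton_iff)
  then have eH: "e \<in> H" "v \<in> e"
    by auto
  have ce: "card e = r" "finite e"
    using partite_uniform[OF H(1,3)] finite_line[OF H(1)] eH by auto
  have c: "card (e - {v}) = r - 1"
    using ce eH by simp
  \<comment> \<open>The smaller set must still meet \<open>e\<close> itself.\<close>
  with \<open>r \<ge> 2\<close> have "e - {v} \<noteq> {}"
    by (metis One_nat_def Suc_1 card.empty diff_is_0_eq not_less_eq_eq)
  have "cover V H (e - {v})"
    unfolding cover_def
  proof (intro conjI ballI)
    show "e - {v} \<subseteq> V"
      using H(1) eH by (auto simp: hypergraph_def)
    fix f assume f: "f \<in> H"
    show "(e - {v}) \<inter> f \<noteq> {}"
    proof (cases "f = e")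
      case False
      with e f have "v \<notin> f" by blast
      with H(2) eH f show ?thesis by (auto simp: intersecting_def)
    qed (use \<open>e - {v} \<noteq> {}\<close> in blast)
  qed
  from cover_number_le[OF H(1) this] c H(4) \<open>r \<ge> 2\<close> show False
    by simp
qed

lemma degree_2_other_line:
  assumes "degree H v = 2" "e \<in> H" "v \<in> e"
  obtains f where "f \<in> H" "v \<in> f" "f \<noteq> e" "\<And>h. h \<in> H \<Longrightarrow> v \<in> h \<Longrightarrow> h = e \<or> h = f"
proof -
  have "finite {e \<in> H. v \<in> e}" "card ({e \<in> H. v \<in> e} - {e}) = 1"
    using assms card_ge_0_finite[of "{e \<in> H. v \<in> e}"] by (simp_all add: degree_def)
  then obtain f where f: "{e \<in> H. v \<in> e} - {e} = {f}"
    by (auto simp: card_1_singleton_iff)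
  show ?thesis
  proof (rule that)
    show "f \<in> H" "v \<in> f" "f \<noteq> e"
      using f by auto
    show "h = e \<or> h = f" if "h \<in> H" "v \<in> h" for h
      using f that by blast
  qed
qed

lemma degree_2_unique_on_line:
  assumes H: "hypergraph V H" "intersecting H" "partite r V H" "cover_number V H = r"
    and "r \<ge> 2" and e: "e \<in> H" and v: "v \<in> e" "degree H v = 2" and w: "w \<in> e" "degree H w = 2"
  shows "v = w"
proof (rule ccontr)
  assume "v \<noteq> w"
  obtain f where f: "f \<in> H" "v \<in> f" "f \<noteq> e" "\<And>h. h \<in> H \<Longrightarrow> v \<in> h \<Longrightarrow> h = e \<or> h = f"
    using degree_2_other_line[OF v(2) e v(1)] by blast
  obtain g where g: "g \<in> H" "w \<in> g" "g \<noteq> e" "\<And>h. h \<in> H \<Longrightarrow> w \<in> h \<Longrightarrow> h = e \<or> h = g"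
    using degree_2_other_line[OF w(2) e w(1)] by blast
  have ce: "card e = r" "finite e"
    using partite_uniform[OF H(1,3) e] finite_line[OF H(1) e] .
  have V: "h \<subseteq> V" if "h \<in> H" for h
    using H(1) that by (auto simp: hypergraph_def)
  have meet: "h \<inter> h' \<noteq> {}" if "h \<in> H" "h' \<in> H" for h h'
    using H(2) that by (auto simp: intersecting_def)
  have no_cover: "\<not> cover V H C" if "card C < r" for C
    using cover_number_le[OF H(1)] H(4) that by fastforce
  have "f \<noteq> g"
  proof
    assume "f = g"
    have "cover V H (e - {v})"
      unfolding cover_def
    proof (intro conjI ballI)
      fix h assume h: "h \<in> H"
      show "(e - {v}) \<inter> h \<noteq> {}"
      proof (cases "w \<in> h")
        case True
        with w(1) \<open>v \<noteq> w\<close> show ?thesis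
          by blast
      next
        case False
        \<comment> \<open>A line through \<open>v\<close> is \<open>e\<close> or \<open>g\<close>,
          and both contain \<open>w\<close>.\<close>
        then have "v \<notin> h"
          using f(4)[OF h] \<open>f = g\<close> g(2) w(1) by auto
        with meet[OF e h] show ?thesis
          by blast
      qed
    qed (use V[OF e] in blast)
    moreover have "card (e - {v}) < r"
      using ce v(1) \<open>r \<ge> 2\<close> by simp
    ultimately show False
      using no_cover by blast
  qed
  \<comment> \<open>Otherwise \<open>v\<close> or \<open>w\<close> would lie on three distinct
    lines.\<close>
  then have "v \<notin> g" "w \<notin> f"
    using f g by blast+
  obtain x where x: "x \<in> f" "x \<in> g"
    using meet[OF f(1) g(1)] by blast
  \<comment> \<open>Only for \<open>r = 2\<close> is it a problem that the new cover must also meet \<open>e\<close>; there the sides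
    exclude the triangle \<open>e, f, g\<close>.\<close>
  have "e \<noteq> {v, w}"
  proof
    assume evw: "e = {v, w}"
    have "x \<in> V"
      using V[OF f(1)] x(1) by blast
    obtain S where S: "x \<in> S" "\<forall>h\<in>H. \<exists>!u. u \<in> h \<and> u \<in> S"
      by (rule partite_side[OF H(3) \<open>x \<in> V\<close>])
    have "\<exists>u. u \<in> e \<and> u \<in> S"
      using bspec[OF S(2) e] by (rule ex1_implies_ex)
    with evw consider "v \<in> S" | "w \<in> S"
      by auto
    \<comment> \<open>If \<open>v\<close> is in \<open>S\<close>, then \<open>v\<close> and
      \<open>x\<close> are both the unique vertex of \<open>f\<close> in \<open>S\<close>; for
      \<open>w\<close> the same happens on \<open>g\<close>.\<close>
    then show False
    proof cases
      case 1
      then have "x = v" using bspec[OF S(2) f(1)] S(1) x(1) f(2) by metis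
      with x \<open>v \<notin> g\<close> show False by simp
    next
      case 2
      then have "x = w" using bspec[OF S(2) g(1)] S(1) x(2) g(2) by metis
      with x \<open>w \<notin> f\<close> show False by simp
    qed
  qed
  with v w have "e - {v, w} \<noteq> {}"
    by blast
  have "cover V H (insert x (e - {v, w}))"
    unfolding cover_def
  proof (intro conjI ballI)
    show "insert x (e - {v, w}) \<subseteq> V"
      using V[OF e] V[OF f(1)] x(1) by blast
    fix h assume h: "h \<in> H"
    show "insert x (e - {v, w}) \<inter> h \<noteq> {}"
    proof (cases "h = e \<or> h = f \<or> h = g")
      case True
      then show ?thesis
        using x \<open>e - {v, w} \<noteq> {}\<close> by auto
    next
      case False
      then have "v \<notin> h" "w \<notin> h"
        using f(4)[OF h] g(4)[OF h] by auto
      with meet[OF e h] show ?thesis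
        by blast
    qed
  qed
  moreover have "card (insert x (e - {v, w})) < r"
  proof -
    have "card (e - {v, w}) = r - 2"
      using ce v(1) w(1) \<open>v \<noteq> w\<close> by (simp add: card_Diff_subset)
    \<comment> \<open>Positivity rules out truncation in \<open>r - 2\<close>, so adding
      \<open>x\<close> gives at most \<open>r - 1\<close>.\<close>
    moreover have "card (e - {v, w}) > 0"
      using \<open>e - {v, w} \<noteq> {}\<close> ce(2) by (simp add: card_gt_0_iff)
    ultimately show ?thesis
      using ce(2) card_insert_if[of "e - {v, w}" x] by (simp split: if_splits)
  qed
  ultimately show False
    using no_cover by blast
qed

text \<open>The incidences of degree-2 vertices with lines number twice the vertices, and each line
  carries at most one of them.\<close>

lemma card_degree_2:
  assumes H: "hypergraph V H" "intersecting H" "partite r V H" "cover_number V H = r" and "r \<ge> 2"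
  shows "2 * card {v \<in> V. degree H v = 2} \<le> card H"
proof -
  define D where "D = {v \<in> V. degree H v = 2}"
  have fin: "finite D" "finite H"
    using H(1) finite_lines by (auto simp: hypergraph_def D_def)
  have "2 * card D = (\<Sum>v\<in>D. degree H v)"
    by (simp add: D_def)
  also have "\<dots> = (\<Sum>e\<in>H. card (D \<inter> e))"
    using sum_degree_mult[OF fin, of "\<lambda>_. 1"] by simp
  also have "\<dots> \<le> (\<Sum>e\<in>H. 1)"
  proof (rule sum_mono)
    fix e assume e: "e \<in> H"
    have "v = w" if "v \<in> D \<inter> e" "w \<in> D \<inter> e" for v w
      using that by (intro degree_2_unique_on_line[OF H \<open>r \<ge> 2\<close> e]) (auto simp: D_def)
    then show "card (D \<inter> e) \<le> 1"
      using fin(1) by (simp add: card_le_Suc0_iff_eq)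
  qed
  finally show ?thesis
    by (simp add: D_def)
qed

section \<open>The quadratic inequality in the number of lines\<close>

theorem theorem2p3:
  fixes V :: "'a set" and H :: "'a set set" and r \<Delta> :: nat
  assumes "r \<ge> 2"
    and "hypergraph V H"
    and "intersecting H"
    and "partite r V H"
    and "\<forall>v\<in>V. degree H v > 0"
    and "cover_number V H = r"
    and "max_degree V H = \<Delta>"
  shows "(real r + 1 / 2)\<^sup>2 * (real \<Delta>)\<^sup>2 + 4 * (real r)\<^sup>2
           \<ge> (8 * (real r)\<^sup>2 - 2 * real r) * real \<Delta>"
proof -
  note H = assms(2,3,4,6)
  define n where "n = card H"
  define D where "D = {v \<in> V. degree H v = 2}"
  define d where "d v = real (degree H v)" for v
  have fin: "finite V" "finite H"
    using assms(2) finite_lines by (auto simp: hypergraph_def)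
  have unif: "card e = r" if "e \<in> H" for e
    using partite_uniform[OF assms(2,4) that] .
  have "(\<Sum>v\<in>V. degree H v) = (\<Sum>e\<in>H. card (V \<inter> e))"
    using sum_degree_mult[OF fin, of "\<lambda>_. 1"] by simp
  also have "\<dots> = (\<Sum>e\<in>H. r)"
    using assms(2) unif by (intro sum.cong) (auto simp: hypergraph_def Int_absorb1)
  finally have sum1: "(\<Sum>v\<in>V. d v) = real n * real r"
    unfolding d_def n_def by (simp flip: of_nat_sum)
  have "card H * (card H - 1 + r) \<le> (\<Sum>v\<in>V. (degree H v)\<^sup>2)"
    using assms(2,3) unif by (rule sum_degree_squares)
  moreover have "(\<Sum>v\<in>V. (d v)\<^sup>2) = real (\<Sum>v\<in>V. (degree H v)\<^sup>2)"
    by (simp add: d_def)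
  ultimately have "real (card H * (card H - 1 + r)) \<le> (\<Sum>v\<in>V. (d v)\<^sup>2)"
    by (simp only: of_nat_le_iff)
  \<comment> \<open>Truncation in \<open>card H - 1\<close> can only raise the value, so the bound
    passes to real subtraction.\<close>
  moreover have "real n * (real n - 1 + real r) \<le> real (card H * (card H - 1 + r))"
    unfolding n_def of_nat_mult by (intro mult_left_mono) auto
  ultimately have sum2: "real n * (real n - 1 + real r) \<le> (\<Sum>v\<in>V. (d v)\<^sup>2)"
    by linarith
  have sizeV: "real r * real r \<le> real (card V)"
    using partite_card_vertices[OF assms(2,4,6)] by (simp flip: of_nat_mult)
  have sizeD: "2 * real (card D) \<le> real n"
    using card_degree_2[OF H assms(1)] unfolding D_def n_def by linarith
  have V_ne: "V \<noteq> {}"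
    using partite_card_vertices[OF assms(2,4,6)] assms(1) by auto
  have ge2: "2 \<le> d v" and le: "d v \<le> \<Delta>" if "v \<in> V" for v
    using degree_ge_2[OF H assms(1)] degree_le_max_degree[OF fin(1) that] assms(5,7) that
    unfolding d_def by fastforce+
  with V_ne have \<Delta>: "real \<Delta> \<ge> 2"
    by fastforce
  \<comment> \<open>This is \<open>(d v - 3) * (real \<Delta> - d v) \<ge> 0\<close> expanded. At
    degree 2 the product equals \<open>-(real \<Delta> - 2)\<close>, which the last term corrects
    exactly.\<close>
  have "(d v)\<^sup>2 \<le> (real \<Delta> + 3) * d v - 3 * real \<Delta> + (if v \<in> D then real \<Delta> - 2 else 0)" if "v \<in> V" for v
  proof (cases "v \<in> D")
    case True
    then show ?thesis
      by (simp add: D_def d_def)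
  next
    case False
    with that ge2[OF that] have "d v \<ge> 3"
      unfolding D_def d_def by fastforce
    with le[OF that] have "0 \<le> (d v - 3) * (real \<Delta> - d v)"
      by simp
    with False show ?thesis
      by (simp add: algebra_simps power2_eq_square)
  qed
  then have "(\<Sum>v\<in>V. (d v)\<^sup>2)
      \<le> (\<Sum>v\<in>V. (real \<Delta> + 3) * d v - 3 * real \<Delta> + (if v \<in> D then real \<Delta> - 2 else 0))"
    by (intro sum_mono) simp
  also have "\<dots> = (real \<Delta> + 3) * (real n * real r) - 3 * real \<Delta> * card V + (real \<Delta> - 2) * card D"
  proof -
    have "V \<inter> {v. v \<in> D} = D"
      by (auto simp: D_def)
    then show ?thesis
      using fin(1) sum1 by (simp add: sum.distrib sum_subtractf sum.If_cases flip: sum_distrib_left)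
  qed
  \<comment> \<open>The vertex count has a nonpositive coefficient, so its lower bound is used; the
    coefficient of \<open>card D\<close> is nonnegative, so its upper bound is used.\<close>
  also have "\<dots> \<le> (real \<Delta> + 3) * (real n * real r) - 3 * real \<Delta> * (real r * real r) + (real \<Delta> - 2) * (real n / 2)"
  proof -
    have "3 * real \<Delta> * (real r * real r) \<le> 3 * real \<Delta> * card V"
      using sizeV by (intro mult_left_mono) auto
    moreover have "(real \<Delta> - 2) * card D \<le> (real \<Delta> - 2) * (real n / 2)"
      using sizeD \<Delta> by (intro mult_left_mono) auto
    ultimately show ?thesis by simp
  qed
  \<comment> \<open>The \<open>-n\<close> from \<open>n * (n - 1)\<close> cancels against the
    \<open>-n\<close> from \<open>(real \<Delta> - 2) * (n / 2)\<close>.\<close>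
  finally have quadratic:
    "(real n)\<^sup>2 - ((real r + 1 / 2) * real \<Delta> + 2 * real r) * n + 3 * (real r)\<^sup>2 * real \<Delta> \<le> 0"
    using sum2 by (simp add: algebra_simps power2_eq_square diff_divide_distrib)
  \<comment> \<open>With \<open>b\<close> the linear coefficient and \<open>c\<close> the constant
    term, the square is \<open>4 * (n\<^sup>2 - b * n + c) + b\<^sup>2 - 4 * c\<close>, hence
    \<open>b\<^sup>2 \<ge> 4 * c\<close>. The cross term of \<open>b\<^sup>2\<close> turns
    \<open>12 * r\<^sup>2\<close> into \<open>8 * r\<^sup>2 - 2 * r\<close>.\<close>
  have "0 \<le> (2 * real n - ((real r + 1 / 2) * real \<Delta> + 2 * real r))\<^sup>2"
    by simp
  with quadratic show ?thesis
    by (simp add: algebra_simps power2_eq_square)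
qed

end
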